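(* Let $N\ge1$ be an integer, $1<p<2$, $q>1$, $\alpha>0$, $\delta=\frac{p}{2-p}$. Assume $N\le\delta<\alpha$ or $N<\delta=\alpha$. Then for any $m>0$, any solution $w\not\equiv0$ of $$(|w'|^{p-2}w')'+\frac{N-1}{r}|w'|^{p-2}w'+rw'+\alpha w+|w|^{q-1}w=0\qquad (E)$$ has an infinite number of zeros in $[m,\infty)$.
   Context: A solution of (E) is a function $w\in C^1((R_w,\infty))$, for some $0\le R_w<m$, with $|w'|^{p-2}w'\in C^1((R_w,\infty))$, satisfying (E) on $(R_w,\infty)$. *)

theory Defs
  imports "HOL-Analysis.Analysis"
begin

(* |s|^(a-1) s; takes the value 0 at s = 0, also when the exponent a - 1 is negative *)
definition signed_power :: "real \<Rightarrow> real \<Rightarrow> real" where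
  "signed_power a s = \<bar>s\<bar> powr (a - 1) * s"

definition flux :: "real \<Rightarrow> (real \<Rightarrow> real) \<Rightarrow> real \<Rightarrow> real" where
  "flux p w r = signed_power (p - 1) (deriv w r)"

definition solution_E ::
    "nat \<Rightarrow> real \<Rightarrow> real \<Rightarrow> real \<Rightarrow> real \<Rightarrow> (real \<Rightarrow> real) \<Rightarrow> bool" where
  "solution_E N p q \<alpha> R w \<longleftrightarrow>
     w C1_differentiable_on {R<..} \<and>
     flux p w C1_differentiable_on {R<..} \<and>
     (\<forall>r>R. deriv (flux p w) r + (real N - 1) / r * flux p w r
             + r * deriv w r + \<alpha> * w r + signed_power q (w r) = 0)"

end

theory Submission
  imports Defs
begin

text \<open>
  Suppose that \<open>w\<close> has finitely many zeros in \<open>[m, \<infinity>)\<close>; up to sign, \<open>w > 0\<close> near infinity. In the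
  variables \<open>r = e\<^sup>t\<close>, \<open>y = r\<^sup>\<delta> w\<close>, \<open>Y = - r\<^bsup>\<delta>-1\<^esup> |w'|\<^bsup>p-2\<^esup> w'\<close>, and with \<open>k = 1 / (p - 1) > 1\<close>, the
  equation becomes
  \<open>y' = \<delta> y - |Y|\<^bsup>k-1\<^esup> Y\<close> and \<open>Y' = (\<delta> - N) Y - |Y|\<^bsup>k-1\<^esup> Y + \<alpha> y + g\<close> with \<open>g \<ge> 0\<close>.
  Eventually \<open>Y \<ge> 0\<close>, so \<open>Z = Y - y\<close> satisfies \<open>Z' = (\<delta> - N) Y + (\<alpha> - \<delta>) y + g \<ge> 0\<close>. If \<open>Z\<close> becomes
  positive, it grows at least linearly, and the superlinear term drives \<open>y\<close> below \<open>0\<close>. If \<open>Z \<le> 0\<close>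
  forever, then \<open>y' \<ge> \<delta> y - y\<^sup>k\<close> keeps \<open>y\<close>, and then also \<open>Y\<close>, above a positive constant, so \<open>Z\<close>
  again grows at least linearly: a contradiction in both cases.
\<close>

section \<open>Algebra of signed powers\<close>

lemma signed_power_minus: "signed_power a (- x) = - signed_power a x"
  by (simp add: signed_power_def)

lemma signed_power_mult: "signed_power a (x * y) = signed_power a x * signed_power a y"
  by (simp add: signed_power_def abs_mult powr_mult)

lemma signed_power_pos: "x > 0 \<Longrightarrow> signed_power a x = x powr a"
  by (simp add: signed_power_def powr_diff)

lemma signed_power_0 [simp]: "signed_power a 0 = 0"
  by (simp add: signed_power_def)

text \<open>With \<open>a = p - 1\<close> this recovers \<open>deriv w\<close> from
  \<open>flux p w\<close>. Oddness reduces it to \<open>x > 0\<close>, where exponents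
  multiply.\<close>

lemma signed_power_inverse:
  assumes "a \<noteq> 0"
  shows "signed_power (1 / a) (signed_power a x) = x"
proof -
  have pos: "signed_power (1 / a) (signed_power a x) = x" if "x > 0" for x
    using that assms by (simp add: signed_power_pos powr_powr)
  consider "x > 0" | "x = 0" | "- x > 0" by linarith
  then show ?thesis
  proof cases
    case 3
    then show ?thesis using pos[of "- x"] by (simp add: signed_power_minus)
  qed (auto simp: pos)
qed

section \<open>Powers against linear functions, and differential inequalities\<close>

lemma powr_superlinear_at_top:
  fixes c k :: real
  assumes "k > 1"
  obtains M where "M > 0" "\<And>x. x \<ge> M \<Longrightarrow> c * x \<le> x powr k"
proof
  \<comment> \<open>\<open>M powr (k - 1) = max c 1\<close>; the maximum with 1 keeps
    \<open>M\<close> positive even if \<open>c \<le> 0\<close>.\<close>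
  define M where "M = max c 1 powr (1 / (k - 1))"
  show "M > 0" by (simp add: M_def)
  fix x assume x: "x \<ge> M"
  have "c \<le> M powr (k - 1)" using assms by (simp add: M_def powr_powr)
  also have "\<dots> \<le> x powr (k - 1)"
    using x assms \<open>M > 0\<close> by (intro powr_mono2) auto
  finally have "c * x \<le> x powr (k - 1) * x"
    using x \<open>M > 0\<close> by (intro mult_right_mono) auto
  then show "c * x \<le> x powr k" using x \<open>M > 0\<close> by (simp add: powr_diff)
qed

lemma powr_superlinear_at_0:
  fixes c k :: real
  assumes "k > 1" "c > 0"
  obtains M where "M > 0" "\<And>x. 0 < x \<Longrightarrow> x \<le> M \<Longrightarrow> x powr k < c * x"
proof
  \<comment> \<open>Halving \<open>c\<close> makes the final inequality strict.\<close>
  define M where "M = (c / 2) powr (1 / (k - 1))"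
  show "M > 0" using assms by (simp add: M_def)
  fix x assume x: "0 < x" "x \<le> M"
  have "x powr (k - 1) \<le> M powr (k - 1)"
    using x assms by (intro powr_mono2) auto
  also have "\<dots> < c" using assms by (simp add: M_def powr_powr)
  finally have "x powr (k - 1) * x < c * x"
    using x by (intro mult_strict_right_mono) auto
  then show "x powr k < c * x" using x by (simp add: powr_diff)
qed

lemma unbounded_if_deriv_ge:
  fixes f f' :: "real \<Rightarrow> real"
  assumes deriv: "\<And>t. t \<ge> a \<Longrightarrow> (f has_real_derivative f' t) (at t)"
    and ge: "\<And>t. t \<ge> a \<Longrightarrow> f' t \<ge> c" and "c > 0"
  obtains t where "t \<ge> a" "f t \<ge> B"
proof
  \<comment> \<open>By this time a line of slope \<open>c\<close> has climbed
    \<open>\<bar>B - f a\<bar>\<close>, and \<open>f\<close> climbs at least as fast.\<close>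
  define t where "t = a + \<bar>B - f a\<bar> / c"
  show ta: "t \<ge> a" using \<open>c > 0\<close> by (simp add: t_def)
  have "f a - c * a \<le> f t - c * t"
  proof (rule DERIV_nonneg_imp_nondecreasing[OF ta])
    fix x assume "a \<le> x" "x \<le> t"
    then show "\<exists>d. ((\<lambda>x. f x - c * x) has_real_derivative d) (at x) \<and> 0 \<le> d"
      using deriv[of x] ge[of x] by (intro exI[of _ "f' x - c"]) (auto intro!: derivative_eq_intros)
  qed
  moreover have "c * t - c * a = \<bar>B - f a\<bar>" using \<open>c > 0\<close> by (simp add: t_def algebra_simps)
  ultimately show "f t \<ge> B" by linarith
qed

text \<open>At the last time \<open>s\<close> before \<open>t\<close> with
  \<open>f s \<ge> c\<close>, continuity forces \<open>f s = c\<close>. The positive derivative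
  there lifts \<open>f\<close> above \<open>c\<close> just after \<open>s\<close>, which is
  absurd.\<close>

lemma lower_barrier:
  fixes f f' :: "real \<Rightarrow> real"
  assumes deriv: "\<And>t. t \<ge> a \<Longrightarrow> (f has_real_derivative f' t) (at t)"
    and pos: "\<And>t. t \<ge> a \<Longrightarrow> f t = c \<Longrightarrow> f' t > 0"
    and "f a \<ge> c" "t \<ge> a"
  shows "f t \<ge> c"
proof (rule ccontr)
  assume neg: "\<not> f t \<ge> c"
  define S where "S = {x \<in> {a..t}. c \<le> f x}"
  define s where "s = Sup S"
  have cont: "continuous_on {a..t} f"
    by (intro continuous_at_imp_continuous_on ballI DERIV_isCont[OF deriv]) auto
  have "S = {a..t} \<inter> f -` {c..}" by (auto simp: S_def)
  then have "closed S" using continuous_closed_preimage[OF cont] by simp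
  moreover have ne: "S \<noteq> {}" "bdd_above S"
    using assms(3,4) by (auto simp: S_def intro!: bdd_aboveI[of _ t])
  ultimately have "s \<in> S" unfolding s_def by (intro closed_contains_Sup) auto
  then have s: "a \<le> s" "s < t" "c \<le> f s"
    using neg by (auto simp: S_def less_le)
  have beyond: "f x < c" if "s < x" "x \<le> t" for x
    using that cSup_upper[OF _ ne(2), of x] s by (force simp: S_def s_def not_le)
  have "f s = c"
  proof (rule ccontr)
    assume "f s \<noteq> c"
    then have "f t \<le> c" "c \<le> f s" "c < f s" using s neg by auto
    moreover have "continuous_on {s..t} f" using cont s by (auto intro: continuous_on_subset)
    ultimately obtain x where "s \<le> x" "x \<le> t" "f x = c"
      using IVT2'[of f t c s] s by auto
    with beyond[of x] \<open>f s \<noteq> c\<close> show False by (cases "x = s") auto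
  qed
  with DERIV_pos_inc_right[OF deriv[OF s(1)]] pos[OF s(1)]
  obtain d where d: "d > 0" "\<And>h. 0 < h \<Longrightarrow> h < d \<Longrightarrow> f s < f (s + h)" by auto
  define h where "h = min (d / 2) (t - s)"
  have "0 < h" "h < d" "s + h \<le> t" using d(1) s by (auto simp: h_def min_def)
  with d(2)[of h] beyond[of "s + h"] \<open>f s = c\<close> show False by auto
qed

text \<open>Applied with \<open>\<beta> = \<delta> - N\<close> and
  \<open>\<gamma> = \<alpha> - \<delta>\<close>. The coefficient of \<open>y\<close> is written
  \<open>\<gamma> + \<delta>\<close> so that subtracting the two equations leaves
  \<open>\<beta> * Y + \<gamma> * y + g\<close>.\<close>

lemma no_positive_trajectory:
  fixes y Y g :: "real \<Rightarrow> real" and k \<delta> \<beta> \<gamma> a :: real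
  assumes "k > 1" "\<delta> > 0" "\<beta> \<ge> 0" "\<gamma> \<ge> 0" "\<beta> > 0 \<or> \<gamma> > 0"
    and y_pos: "\<And>t. t \<ge> a \<Longrightarrow> y t > 0"
    and g_nonneg: "\<And>t. t \<ge> a \<Longrightarrow> g t \<ge> 0"
    and y_deriv: "\<And>t. t \<ge> a \<Longrightarrow> (y has_real_derivative (\<delta> * y t - signed_power k (Y t))) (at t)"
    and Y_deriv: "\<And>t. t \<ge> a \<Longrightarrow>
      (Y has_real_derivative (\<beta> * Y t - signed_power k (Y t) + (\<gamma> + \<delta>) * y t + g t)) (at t)"
  shows False
proof -
  let ?P = "signed_power k"
  have P_mono: "?P u \<le> ?P v" if "0 \<le> u" "u \<le> v" for u v
    using that assms(1) by (cases "u = 0"; cases "v = 0") (auto simp: signed_power_pos powr_mono2)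
  have ny_deriv: "((\<lambda>t. - y t) has_real_derivative - (\<delta> * y t - ?P (Y t))) (at t)" if "t \<ge> a" for t
    using y_deriv[OF that] by (rule DERIV_minus)
  \<comment> \<open>While \<open>Y < 0\<close>, the term \<open>- ?P (Y t)\<close> is positive in
    both equations. Hence \<open>y\<close> grows without bound and then drives \<open>Y\<close> up
    to 0.\<close>
  have "\<exists>b\<ge>a. Y b \<ge> 0"
  proof (rule ccontr)
    assume "\<not> ?thesis"
    then have neg: "Y t < 0" if "t \<ge> a" for t using that by force
    have P_neg: "?P (Y t) = - ((- Y t) powr k)" if "t \<ge> a" for t
      using signed_power_pos[of "- Y t" k] neg[OF that] by (simp add: signed_power_minus)
    have y_deriv_ge: "\<delta> * y t \<le> \<delta> * y t - ?P (Y t)" if "t \<ge> a" for t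
      using P_neg[OF that] by simp
    have y_ge: "y t \<ge> y b" if "a \<le> b" "b \<le> t" for b t
    proof (rule lower_barrier[OF y_deriv, of b])
      fix x assume "x \<ge> b"
      then show "0 < \<delta> * y x - ?P (Y x)"
        using y_deriv_ge[of x] mult_pos_pos[OF assms(2) y_pos[of x]] that by simp
    qed (use that in auto)
    obtain M where M: "M > 0" "\<And>x. x \<ge> M \<Longrightarrow> \<beta> * x \<le> x powr k"
      using powr_superlinear_at_top[OF assms(1)] by metis
    \<comment> \<open>From this level on, \<open>\<delta> * y\<close> absorbs the worst value
      \<open>- (\<beta> * M)\<close> of \<open>\<beta> * Y - ?P (Y)\<close> and leaves slope
      1.\<close>
    obtain b where b: "b \<ge> a" "y b \<ge> (1 + \<beta> * M) / \<delta>"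
    proof (rule unbounded_if_deriv_ge[where B = "(1 + \<beta> * M) / \<delta>", OF y_deriv, of a])
      fix t assume "t \<ge> a"
      then show "\<delta> * y a \<le> \<delta> * y t - ?P (Y t)"
        using y_deriv_ge[of t] mult_left_mono[OF y_ge[of a t], of \<delta>] assms(2) by linarith
    qed (use y_pos[of a] assms(2) in auto)
    obtain t where "t \<ge> b" "Y t \<ge> 0"
    proof (rule unbounded_if_deriv_ge[where B = 0, OF Y_deriv, of b])
      fix t assume t: "t \<ge> b"
      have "(1 + \<beta> * M) / \<delta> \<le> y t" using y_ge[of b t] b t by linarith
      then have "1 + \<beta> * M \<le> \<delta> * y t" using assms(2) by (simp add: field_simps)
      moreover have "\<beta> * Y t - ?P (Y t) \<ge> - (\<beta> * M)"
      proof (cases "- Y t \<ge> M")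
        case True
        then show ?thesis
          using M(2)[OF True] M(1) P_neg[of t] mult_nonneg_nonneg[of \<beta> M] assms(3) b t
          by (simp del: mult_nonneg_nonneg)
      next
        case False
        then have "\<beta> * (- Y t) \<le> \<beta> * M" using assms(3) by (intro mult_left_mono) auto
        then show ?thesis using P_neg[of t] powr_ge_zero[of "- Y t" k] b t
          by (simp del: powr_ge_zero)
      qed
      moreover have "0 \<le> \<gamma> * y t" "0 \<le> g t"
        using assms(4) y_pos[of t] g_nonneg[of t] b t by auto
      ultimately show "1 \<le> \<beta> * Y t - ?P (Y t) + (\<gamma> + \<delta>) * y t + g t"
        by (simp add: algebra_simps)
    qed (use b in auto)
    with neg[of t] b show False by simp
  qed
  then obtain b where b: "b \<ge> a" "Y b \<ge> 0" by blast
  have Y_nonneg: "Y t \<ge> 0" if "t \<ge> b" for t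
  proof (rule lower_barrier[OF Y_deriv, of b])
    fix x assume "x \<ge> b" "Y x = 0"
    then show "0 < \<beta> * Y x - ?P (Y x) + (\<gamma> + \<delta>) * y x + g x"
      using y_pos[of x] g_nonneg[of x] assms(2,4) b by (simp add: add_pos_nonneg)
  qed (use b that in auto)
  define Z where "Z t = Y t - y t" for t
  have Z_deriv: "(Z has_real_derivative (\<beta> * Y t + \<gamma> * y t + g t)) (at t)" if "t \<ge> b" for t
    unfolding Z_def using y_deriv[of t] Y_deriv[of t] that b
    by (auto intro!: derivative_eq_intros simp: algebra_simps)
  have Z_mono: "Z s \<le> Z t" if "b \<le> s" "s \<le> t" for s t
  proof (rule DERIV_nonneg_imp_nondecreasing[OF that(2)])
    fix x assume "s \<le> x" "x \<le> t"
    then show "\<exists>d. (Z has_real_derivative d) (at x) \<and> 0 \<le> d"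
      using Z_deriv[of x] Y_nonneg[of x] y_pos[of x] g_nonneg[of x] assms(3,4) that b by fastforce
  qed
  have Z_nonpos: "Z t0 \<le> 0" if t0: "t0 \<ge> b" for t0
  proof (rule ccontr)
    define z where "z = Z t0"
    assume "\<not> Z t0 \<le> 0"
    then have z: "z > 0" by (simp add: z_def)
    have Y_ge: "z + y t \<le> Y t" "z \<le> Y t" if "t \<ge> t0" for t
      using Z_mono[of t0 t] y_pos[of t] t0 b that by (auto simp: Z_def z_def)
    have PY_ge: "?P z \<le> ?P (Y t)" if "t \<ge> t0" for t
      using P_mono[of z "Y t"] Y_ge[OF that] z by simp
    \<comment> \<open>Below this level \<open>y' < 0\<close>, since
      \<open>?P (Y) \<ge> ?P z\<close>; \<open>y\<close> would then fall at a fixed rate and reach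
      0. The bound makes \<open>Z\<close> grow through \<open>\<gamma> * y\<close> when
      \<open>\<beta> = 0\<close>.\<close>
    have y_ge: "y t1 \<ge> ?P z / \<delta>" if t1: "t1 \<ge> t0" for t1
    proof (rule ccontr)
      assume "\<not> ?thesis"
      then have lt: "?P z - \<delta> * y t1 > 0" using assms(2) by (simp add: field_simps)
      have le: "- y t \<ge> - y t1" if "t \<ge> t1" for t
      proof (rule lower_barrier[OF ny_deriv, of t1])
        fix x assume "x \<ge> t1" "- y x = - y t1"
        then show "- (\<delta> * y x - ?P (Y x)) > 0" using PY_ge[of x] lt t1 by simp
      qed (use that t0 t1 b in auto)
      obtain t where "t \<ge> t1" "- y t \<ge> 0"
      proof (rule unbounded_if_deriv_ge[where B = 0, OF ny_deriv, of t1])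
        fix t assume t: "t \<ge> t1"
        then have "\<delta> * y t \<le> \<delta> * y t1" using le[of t] assms(2) by simp
        then show "- (\<delta> * y t - ?P (Y t)) \<ge> ?P z - \<delta> * y t1"
          using PY_ge[of t] t t1 by simp
      qed (use lt t0 t1 b in auto)
      with y_pos[of t] t1 t0 b show False by simp
    qed
    \<comment> \<open>Once \<open>Y \<ge> y + M\<close>, the factor \<open>\<delta> + 1\<close>
      yields \<open>?P (Y) \<ge> \<delta> * y + M\<close>, so \<open>y\<close> decreases at rate at
      least \<open>M\<close>.\<close>
    obtain M where M: "M > 0" "\<And>x. x \<ge> M \<Longrightarrow> (\<delta> + 1) * x \<le> x powr k"
      using powr_superlinear_at_top[OF assms(1)] by metis
    obtain t1 where t1: "t1 \<ge> t0" "Z t1 \<ge> M"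
    proof (rule unbounded_if_deriv_ge[where B = M, OF Z_deriv, of t0])
      fix t assume t: "t \<ge> t0"
      show "\<beta> * z + \<gamma> * (?P z / \<delta>) \<le> \<beta> * Y t + \<gamma> * y t + g t"
        using mult_left_mono[OF Y_ge(2)[OF t] assms(3)] mult_left_mono[OF y_ge[OF t] assms(4)]
          g_nonneg[of t] t t0 b by linarith
    next
      have "?P z / \<delta> > 0" using z assms(2) by (simp add: signed_power_pos)
      then show "\<beta> * z + \<gamma> * (?P z / \<delta>) > 0"
        using assms(3-5) z by (metis add_nonneg_pos add_pos_nonneg less_eq_real_def mult_nonneg_nonneg
            mult_pos_pos)
    qed (use t0 in auto)
    obtain t where "t \<ge> t1" "- y t \<ge> 0"
    proof (rule unbounded_if_deriv_ge[where B = 0, OF ny_deriv, of t1])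
      fix t assume t: "t \<ge> t1"
      have Yt: "Y t \<ge> y t + M" using Z_mono[of t1 t] t t1 t0 by (simp add: Z_def)
      have yt: "y t > 0" using y_pos[of t] t t1 t0 b by simp
      have "(\<delta> + 1) * (y t + M) \<le> (\<delta> + 1) * Y t"
        using Yt assms(2) by (intro mult_left_mono) auto
      also have "\<dots> \<le> ?P (Y t)" using M(2)[of "Y t"] Yt yt M(1) by (simp add: signed_power_pos)
      finally have "\<delta> * y t + y t + (\<delta> * M + M) \<le> ?P (Y t)" by (simp add: algebra_simps)
      moreover have "\<delta> * M > 0" using assms(2) M by simp
      ultimately show "- (\<delta> * y t - ?P (Y t)) \<ge> M" using yt by linarith
    qed (use M t0 t1 b in auto)
    with y_pos[of t] t1 t0 b show False by simp
  qed
  have Y_le: "Y t \<le> y t" if "t \<ge> b" for t using Z_nonpos[OF that] by (simp add: Z_def)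
  obtain M where M: "M > 0" "\<And>x. 0 < x \<Longrightarrow> x \<le> M \<Longrightarrow> x powr k < \<delta> * x"
    using powr_superlinear_at_0[OF assms(1,2)] by metis
  \<comment> \<open>The bound \<open>y b\<close> puts the start above the barrier; the bound
    \<open>M\<close> gives \<open>?P c < \<delta> * c\<close>, hence \<open>y' > 0\<close> on it
    because \<open>0 \<le> Y \<le> y\<close>.\<close>
  define c where "c = min (y b) M"
  have c: "c > 0" using M y_pos[of b] b by (simp add: c_def)
  have y_ge: "y t \<ge> c" if "t \<ge> b" for t
  proof (rule lower_barrier[OF y_deriv, of b])
    fix x assume x: "x \<ge> b" "y x = c"
    have "?P (Y x) \<le> ?P c" using P_mono Y_nonneg Y_le x by metis
    also have "\<dots> < \<delta> * c" using M(2)[of c] c by (simp add: signed_power_pos c_def)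
    finally show "0 < \<delta> * y x - ?P (Y x)" using x by simp
  qed (use b that in \<open>auto simp: c_def\<close>)
  obtain L where L: "L > 0" "\<And>x. 0 < x \<Longrightarrow> x \<le> L \<Longrightarrow> x powr k < 1 * x"
    using powr_superlinear_at_0[OF assms(1), of 1] by auto
  \<comment> \<open>This gives \<open>?P d < d \<le> \<delta> * c\<close>, so \<open>Y\<close> has a
    fixed positive slope as long as \<open>Y \<le> d\<close>.\<close>
  define d where "d = min L (\<delta> * c)"
  have d: "d > 0" using L c assms(2) by (simp add: d_def)
  have Pd: "?P d < \<delta> * c" using L(2)[of d] d by (simp add: signed_power_pos d_def)
  have Y_deriv_ge: "\<delta> * c - ?P d \<le> \<beta> * Y t - ?P (Y t) + (\<gamma> + \<delta>) * y t + g t"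
    if "t \<ge> b" "Y t \<le> d" for t
  proof -
    have "0 \<le> \<beta> * Y t" "?P (Y t) \<le> ?P d" "\<delta> * c \<le> \<delta> * y t" "0 \<le> \<gamma> * y t" "0 \<le> g t"
      using Y_nonneg[of t] P_mono[of "Y t" d] y_ge[of t] g_nonneg[of t] c that assms(2-4) b by auto
    then show ?thesis by (simp add: algebra_simps)
  qed
  \<comment> \<open>\<open>Y\<close> may start below \<open>d\<close>, but that slope carries it
    there, after which \<open>d\<close> is a barrier.\<close>
  obtain b' where b': "b' \<ge> b" "Y b' \<ge> d"
  proof (cases "\<exists>t\<ge>b. Y t \<ge> d")
    case False
    show ?thesis
    proof (rule unbounded_if_deriv_ge[where B = d, OF Y_deriv, of b])
      fix t assume "t \<ge> b"
      then show "\<delta> * c - ?P d \<le> \<beta> * Y t - ?P (Y t) + (\<gamma> + \<delta>) * y t + g t"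
        using False by (intro Y_deriv_ge) force+
    qed (use b Pd that in auto)
  qed (use that in blast)
  have Y_ge: "Y t \<ge> d" if "t \<ge> b'" for t
  proof (rule lower_barrier[OF Y_deriv, of b'])
    fix x assume "x \<ge> b'" "Y x = d"
    then show "0 < \<beta> * Y x - ?P (Y x) + (\<gamma> + \<delta>) * y x + g x"
      using Y_deriv_ge[of x] Pd b' by simp
  qed (use b b' that in auto)
  obtain t where "t \<ge> b'" "Z t \<ge> 1"
  proof (rule unbounded_if_deriv_ge[where B = 1, OF Z_deriv, of b'])
    fix t assume t: "t \<ge> b'"
    then have "c \<le> y t" using y_ge[of t] b' by simp
    then show "\<beta> * d + \<gamma> * c \<le> \<beta> * Y t + \<gamma> * y t + g t"
      using mult_left_mono[OF Y_ge[OF t] assms(3)] mult_left_mono[of c "y t" \<gamma>] assms(4)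
        g_nonneg[of t] t b b' by linarith
  next
    show "\<beta> * d + \<gamma> * c > 0"
      using assms(3-5) c d by (metis add_nonneg_pos add_pos_nonneg less_eq_real_def
          mult_nonneg_nonneg mult_pos_pos)
  qed (use b' in auto)
  with Z_nonpos[of t] b' show False by simp
qed

section \<open>From the radial equation to the planar system\<close>

lemma C1_differentiable_on_has_real_derivative:
  assumes "f C1_differentiable_on S" "x \<in> S"
  shows "(f has_real_derivative deriv f x) (at x)"
  using assms unfolding C1_differentiable_on_def
  by (metis DERIV_imp_deriv has_real_derivative_iff_has_vector_derivative)

text \<open>The sign \<open>s\<close> treats \<open>w\<close> and \<open>- w\<close> at once, since
  the equation is odd in \<open>w\<close>. The system is studied for
  \<open>t \<ge> ln T\<close>.\<close>

lemma solution_E_not_eventually_positive: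
  fixes N :: nat and s T :: real
  assumes "1 < p" "p < 2" "\<delta> = p / (2 - p)"
    and range: "(real N \<le> \<delta> \<and> \<delta> < \<alpha>) \<or> (real N < \<delta> \<and> \<delta> = \<alpha>)"
    and "0 \<le> R" "R < T"
    and sol: "solution_E N p q \<alpha> R w"
    and s: "s = 1 \<or> s = - 1"
    and pos: "\<And>r. r \<ge> T \<Longrightarrow> s * w r > 0"
  shows False
proof (rule no_positive_trajectory)
  define k where "k = 1 / (p - 1)"
  define y where "y t = s * (exp (\<delta> * t) * w (exp t))" for t
  define Y where "Y t = - s * (exp ((\<delta> - 1) * t) * flux p w (exp t))" for t
  define g where "g t = s * (exp (\<delta> * t) * signed_power q (w (exp t)))" for t
  \<comment> \<open>This identity singles out \<open>\<delta> = p / (2 - p)\<close>: the weights in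
    \<open>y\<close> and \<open>Y\<close> match, and the system is autonomous apart from
    \<open>g\<close>.\<close>
  have dk: "(\<delta> - 1) * k = \<delta> + 1" using assms(1-3) by (simp add: k_def field_simps)
  have PY: "signed_power k (Y t) = - s * (exp (\<delta> * t) * exp t * deriv w (exp t))" for t
  proof -
    have "signed_power k (- s) = - s" using s by (auto simp: signed_power_def)
    moreover have "k * ((\<delta> - 1) * t) = \<delta> * t + t"
      using arg_cong[OF dk, of "\<lambda>x. x * t"] by (simp add: algebra_simps)
    then have "signed_power k (exp ((\<delta> - 1) * t)) = exp (\<delta> * t) * exp t"
      by (simp add: signed_power_pos powr_def exp_add)
    moreover have "signed_power k (flux p w (exp t)) = deriv w (exp t)"
      unfolding flux_def k_def using assms(1) by (intro signed_power_inverse) simp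
    ultimately show ?thesis by (simp only: Y_def signed_power_mult)
  qed
  have T: "T > 0" using assms(5,6) by simp
  have range_t: "exp t \<ge> T" "exp t > R" if "t \<ge> ln T" for t
  proof -
    have "exp (ln T) \<le> exp t" using that by (simp only: exp_le_cancel_iff)
    then show "exp t \<ge> T" "exp t > R" using T assms(6) by simp_all
  qed
  show "k > 1" using assms(1,2) by (simp add: k_def)
  show "\<delta> > 0" using assms(1-3) by simp
  show "\<delta> - real N \<ge> 0" "\<alpha> - \<delta> \<ge> 0" "\<delta> - real N > 0 \<or> \<alpha> - \<delta> > 0" using range by auto
  fix t assume t: "t \<ge> ln T"
  have w_deriv: "(w has_real_derivative deriv w (exp t)) (at (exp t))"
    and flux_deriv: "(flux p w has_real_derivative deriv (flux p w) (exp t)) (at (exp t))"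
    using sol range_t(2)[OF t] unfolding solution_E_def
    by (auto intro!: C1_differentiable_on_has_real_derivative)
  have "deriv (flux p w) (exp t) + (real N - 1) / exp t * flux p w (exp t)
      + exp t * deriv w (exp t) + \<alpha> * w (exp t) + signed_power q (w (exp t)) = 0"
    using sol range_t(2)[OF t] unfolding solution_E_def by blast
  \<comment> \<open>The factor \<open>exp t\<close> clears the denominator and turns the first term
    into the \<open>t\<close>-derivative of \<open>flux p w (exp t)\<close>.\<close>
  then have "exp t * (deriv (flux p w) (exp t) + (real N - 1) / exp t * flux p w (exp t)
      + exp t * deriv w (exp t) + \<alpha> * w (exp t) + signed_power q (w (exp t))) = 0"
    by (simp only: mult_zero_right)
  then have eq: "exp t * deriv (flux p w) (exp t) = - (real N - 1) * flux p w (exp t)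
      - exp t * (exp t * deriv w (exp t) + \<alpha> * w (exp t) + signed_power q (w (exp t)))"
    by (simp add: distrib_left) (simp add: algebra_simps)
  show "y t > 0" using pos[OF range_t(1)[OF t]]
    by (simp add: y_def mult.left_commute[of s])
  show "g t \<ge> 0" using pos[OF range_t(1)[OF t]]
    by (simp add: g_def signed_power_def mult.left_commute[of s])
  have w_exp: "((\<lambda>t. w (exp t)) has_real_derivative deriv w (exp t) * exp t) (at t)"
    by (rule DERIV_chain2[OF w_deriv DERIV_exp])
  have flux_exp: "((\<lambda>t. flux p w (exp t)) has_real_derivative deriv (flux p w) (exp t) * exp t) (at t)"
    by (rule DERIV_chain2[OF flux_deriv DERIV_exp])
  show "(y has_real_derivative \<delta> * y t - signed_power k (Y t)) (at t)"
    unfolding PY y_def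
    by (rule derivative_eq_intros w_exp refl | simp add: algebra_simps)+
  have exp1: "exp ((\<delta> - 1) * t) * exp t = exp (\<delta> * t)"
    by (simp add: exp_add[symmetric] algebra_simps)
  have "(Y has_real_derivative
      - s * (exp ((\<delta> - 1) * t) * (\<delta> - 1) * flux p w (exp t)
        + exp ((\<delta> - 1) * t) * (exp t * deriv (flux p w) (exp t)))) (at t)"
    unfolding Y_def by (rule derivative_eq_intros flux_exp refl | simp add: algebra_simps)+
  moreover have "- s * (exp ((\<delta> - 1) * t) * (\<delta> - 1) * flux p w (exp t)
        + exp ((\<delta> - 1) * t) * (exp t * deriv (flux p w) (exp t)))
      = (\<delta> - real N) * Y t - signed_power k (Y t) + (\<alpha> - \<delta> + \<delta>) * y t + g t"
    unfolding PY unfolding y_def g_def Y_def exp1[symmetric] eq by (simp add: algebra_simps)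
  ultimately show "(Y has_real_derivative
      (\<delta> - real N) * Y t - signed_power k (Y t) + (\<alpha> - \<delta> + \<delta>) * y t + g t) (at t)" by simp
qed

section \<open>Constant sign beyond the last zero\<close>

theorem proposition4p5:
  fixes N :: nat and p q \<alpha> \<delta> m R :: real and w :: "real \<Rightarrow> real"
  assumes "N \<ge> 1" and "1 < p" and "p < 2" and "q > 1" and "\<alpha> > 0"
    and "\<delta> = p / (2 - p)"
    and "(real N \<le> \<delta> \<and> \<delta> < \<alpha>) \<or> (real N < \<delta> \<and> \<delta> = \<alpha>)"
    and "m > 0"
    and "0 \<le> R" and "R < m"
    and "solution_E N p q \<alpha> R w"
    and "\<exists>r>R. w r \<noteq> 0"
  shows "infinite {r \<in> {m..}. w r = 0}"
proof
  assume "finite {r \<in> {m..}. w r = 0}"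
  then have "bdd_above {r \<in> {m..}. w r = 0}" by (rule bdd_above_finite)
  then obtain B where B: "r \<le> B" if "r \<ge> m" "w r = 0" for r
    unfolding bdd_above_def by blast
  \<comment> \<open>Adding 1 places \<open>T\<close> strictly beyond every zero in
    \<open>{m..}\<close>.\<close>
  define T where "T = max m (B + 1)"
  have T: "T \<ge> m" "w r \<noteq> 0" if "r \<ge> T" for r
    using B[of r] that by (auto simp: T_def)
  have T_gt: "R < T" using assms(10) by (simp add: T_def)
  have cont: "isCont w r" if "r > R" for r
    using assms(11) C1_differentiable_on_has_real_derivative[of w "{R<..}" r] that
    by (auto simp: solution_E_def dest: DERIV_isCont)
  define s where "s = sgn (w T)"
  have s: "s = 1 \<or> s = - 1" using T(2)[of T] by (auto simp: s_def sgn_if)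
  have "s * w r > 0" if "r \<ge> T" for r
  proof (rule ccontr)
    assume "\<not> ?thesis"
    then have "s * w r \<le> 0" "0 \<le> s * w T" by (auto simp: s_def sgn_if)
    moreover have "\<forall>x. T \<le> x \<and> x \<le> r \<longrightarrow> isCont (\<lambda>x. s * w x) x"
      using cont T_gt by simp
    ultimately have "\<exists>x\<ge>T. x \<le> r \<and> s * w x = 0"
      using IVT2[of "\<lambda>x. s * w x" r 0 T] that by simp
    then obtain x where "x \<ge> T" "s * w x = 0" by blast
    with T(2)[of x] s show False by auto
  qed
  with solution_E_not_eventually_positive[OF assms(2,3,6,7,9) T_gt assms(11) s] show False by blast
qed

end
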